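(* Let $q\geq 2$ be an integer and let $S=\langle n,n+1,\dots,n+t\rangle$ with integers $\lceil\frac{n-1}{2}\rceil\leq t<n$ and $t\neq 1$. (1) If $q\leq t+1$, then $GM_q(S)=3+(q-1)n-\left\lceil\frac nq\right\rceil+t$. (2) If $t+2\leq q\leq n-1$, then $$GM_q(S)=4+(q-1)n+q-2\left\lceil\frac nq\right\rceil+\left\lfloor\frac{t+n}{q}\right\rfloor-\max\left\{\left\lfloor\frac{t+n}{q}\right\rfloor,\ \min\left\{1+\left\lfloor\frac nq\right\rfloor,\ t\right\}\right\}.$$ (3) If $n\leq q$, then $GM_q(S)=2+qn-\left\lceil\frac{2n}{q}\right\rceil+\left\lfloor\frac{t+n}{q}\right\rfloor$.
   Context: $\langle n,\dots,n+t\rangle$ is the set of $\mathbb N$-linear combinations of $n,\dots,n+t$. Write $S^*=S\setminus\{0\}$, $qS^*+S=\{qx+y: x\in S^*,\ y\in S\}$, and $GM_q(S):=\#\big(S\setminus (qS^*+S)\big)+1$. *)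

theory Defs
  imports Complex_Main
begin

definition nat_combinations :: "nat set \<Rightarrow> nat set" where
  "nat_combinations A = {\<Sum>a\<in>A. c a * a | c :: nat \<Rightarrow> nat. True}"
  (* intended for finite A only, since a sum over an infinite set is 0 *)

definition dilate_sum :: "nat \<Rightarrow> nat set \<Rightarrow> nat set" where
  "dilate_sum q S = {q * x + y | x y. x \<in> S - {0} \<and> y \<in> S}"

(* For a numerical semigroup S (cofinite in the naturals) the set counted here is finite,
   so card is the true cardinality. *)
definition GM :: "nat \<Rightarrow> nat set \<Rightarrow> nat" where
  "GM q S = card (S - dilate_sum q S) + 1"

end

theory Submission
  imports Defs
begin

text \<open>
  Since \<open>n \<le> 2 * t + 1\<close>, the semigroup is \<open>{0} \<union> {n..n + t} \<union> {2 * n..}\<close>.  Every element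
  of \<open>q S\<^sup>* + S\<close> is at least \<open>q n\<close>, and everything from \<open>q n + 2 n\<close> on belongs to it, so
  only the window from \<open>q n\<close> to \<open>q n + 2 n\<close> matters.  Its lower half contains exactly the
  multiples of \<open>q\<close>, counted from \<open>q n\<close>.  Its upper half is covered by the translates of
  \<open>{0..t}\<close> by multiples of \<open>q\<close>, up to a gap that is empty if \<open>q \<le> t + 1\<close>; otherwise there is
  one gap, which contains at most one further multiple of \<open>q\<close>.
\<close>

section \<open>Combinations of an interval of generators\<close>

lemma nat_combinationsI: "(\<Sum>a\<in>A. c a * a) \<in> nat_combinations A"
  unfolding nat_combinations_def by blast

lemma nat_combinations_zero: "0 \<in> nat_combinations A"
  using nat_combinationsI[of "\<lambda>_. 0" A] by simp

lemma nat_combinations_base: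
  assumes "finite A" "a \<in> A"
  shows "a \<in> nat_combinations A"
proof -
  have "(\<Sum>b\<in>A. (if b = a then 1 else 0) * b) = (\<Sum>b\<in>A. if b = a then b else 0)"
    by (rule sum.cong) auto
  also have "\<dots> = a"
    using assms by simp
  finally show ?thesis
    using nat_combinationsI[of "\<lambda>b. if b = a then 1 else 0" A] by (simp only:)
qed

lemma nat_combinations_add:
  assumes "x \<in> nat_combinations A" "y \<in> nat_combinations A"
  shows "x + y \<in> nat_combinations A"
proof -
  obtain c d where "x = (\<Sum>a\<in>A. c a * a)" "y = (\<Sum>a\<in>A. d a * a)"
    using assms unfolding nat_combinations_def by auto
  then have "x + y = (\<Sum>a\<in>A. (c a + d a) * a)"
    by (simp add: sum.distrib algebra_simps)
  then show ?thesis
    using nat_combinationsI[of "\<lambda>a. c a + d a" A] by (simp only:)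
qed

text \<open>A combination with coefficient sum \<open>k\<close> lies between \<open>k * n\<close>
  and \<open>k * (n + t)\<close>, so \<open>k = 0\<close>, \<open>k = 1\<close> and
  \<open>k \<ge> 2\<close> account for the three pieces. Conversely, sums of two generators fill
  \<open>{2 * n..2 * n + 2 * t}\<close>, which has at least \<open>n\<close> elements, and adding
  \<open>n\<close> repeatedly reaches everything above.\<close>

lemma nat_combinations_interval:
  fixes n t :: nat
  assumes "0 < n" "n \<le> 2 * t + 1"
  shows "nat_combinations {n..n + t} = {0} \<union> {n..n + t} \<union> {2 * n..}"
proof (intro equalityI subsetI)
  fix m assume "m \<in> nat_combinations {n..n + t}"
  then obtain c where m: "m = (\<Sum>a\<in>{n..n + t}. c a * a)"
    unfolding nat_combinations_def by auto
  define k where "k = sum c {n..n + t}"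
  have lower: "k * n \<le> m"
    unfolding m k_def sum_distrib_right by (rule sum_mono) auto
  have upper: "m \<le> k * (n + t)"
    unfolding m k_def sum_distrib_right by (rule sum_mono) auto
  consider "k = 0" | "k = 1" | "2 \<le> k" by linarith
  then show "m \<in> {0} \<union> {n..n + t} \<union> {2 * n..}"
  proof cases
    case 3
    then have "2 * n \<le> k * n" by (rule mult_right_mono) simp
    with lower have "2 * n \<le> m" by linarith
    then show ?thesis by simp
  qed (use lower upper in auto)
next
  fix m assume "m \<in> {0} \<union> {n..n + t} \<union> {2 * n..}"
  then consider "m = 0" | "m \<in> {n..n + t}" | "2 * n \<le> m" by auto
  then show "m \<in> nat_combinations {n..n + t}"
  proof cases
    case 3
    then show ?thesis
    proof (induction m rule: less_induct)
      case (less m)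
      show ?case
      proof (cases "m \<le> 2 * n + 2 * t")
        case True
        \<comment> \<open>The excess over \<open>2 * n\<close> goes to the first generator up to its
          limit \<open>t\<close>; at most \<open>t\<close> is left for the second.\<close>
        define i where "i = min t (m - 2 * n)"
        have "m = (n + i) + (m - n - i)" "n + i \<in> {n..n + t}" "m - n - i \<in> {n..n + t}"
          using True less.prems unfolding i_def by (auto simp: min_def)
        then show ?thesis
          by (metis nat_combinations_add nat_combinations_base finite_atLeastAtMost)
      next
        case False
        \<comment> \<open>Here \<open>m \<ge> 2 * n + 2 * t + 1 \<ge> 3 * n\<close>, so
          \<open>m - n\<close> is still at least \<open>2 * n\<close>.\<close>
        have "m - n \<in> nat_combinations {n..n + t}"
          using less.IH[of "m - n"] False assms by simp
        then show ?thesis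
          using nat_combinations_add[of "m - n" "{n..n + t}" n] nat_combinations_base[of "{n..n + t}" n]
            False by simp
      qed
    qed
  qed (auto intro: nat_combinations_zero nat_combinations_base)
qed

section \<open>Membership in the window above \<open>q * n\<close>\<close>

text \<open>With \<open>x = n + i\<close> the equation becomes \<open>m = q * i + y\<close>. Nonzero
  elements of \<open>S\<close> are at least \<open>n > m\<close>, so \<open>y = 0\<close>;
  conversely \<open>2 * i \<le> m < n \<le> 2 * t + 1\<close> makes \<open>n + i\<close> a
  generator.\<close>

lemma dilate_sum_window_lower:
  fixes n t q m :: nat
  defines "S \<equiv> {0} \<union> {n..n + t} \<union> {2 * n..}"
  assumes "0 < n" "n \<le> 2 * t + 1" "2 \<le> q" "m < n"
  shows "q * n + m \<in> dilate_sum q S \<longleftrightarrow> q dvd m"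
proof
  assume "q * n + m \<in> dilate_sum q S"
  then obtain x y where xy: "x \<in> S - {0}" "y \<in> S" "q * n + m = q * x + y"
    unfolding dilate_sum_def by auto
  obtain i where i: "x = n + i"
    using xy(1) unfolding S_def by (auto dest!: le_Suc_ex)
  have m: "m = q * i + y"
    using xy(3) unfolding i by (simp add: algebra_simps)
  then have "y = 0"
    using xy(2) assms unfolding S_def by auto
  with m show "q dvd m" by simp
next
  assume "q dvd m"
  then obtain i where i: "m = q * i" by auto
  have "2 * i \<le> q * i" using assms by simp
  then have "i \<le> t" using i assms by linarith
  then have "n + i \<in> S - {0}" "0 \<in> S" "q * n + m = q * (n + i) + 0"
    using assms i unfolding S_def by (auto simp: algebra_simps)
  then show "q * n + m \<in> dilate_sum q S"
    unfolding dilate_sum_def by blast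
qed

text \<open>With \<open>x = n + i\<close> the equation becomes \<open>n + j = q * i + y\<close>,
  where \<open>y < 2 * n\<close>. The disjuncts correspond to \<open>y\<close> being a generator and
  to \<open>y = 0\<close>.\<close>

lemma dilate_sum_window_upper:
  fixes n t q j :: nat
  defines "S \<equiv> {0} \<union> {n..n + t} \<union> {2 * n..}"
  assumes "0 < n" "n \<le> 2 * t + 1" "2 \<le> q" "j < n"
  shows "q * n + n + j \<in> dilate_sum q S \<longleftrightarrow>
    (\<exists>i. q * i \<le> j \<and> j \<le> q * i + t) \<or> (\<exists>i\<le>t. n + j = q * i)"
proof
  assume "q * n + n + j \<in> dilate_sum q S"
  then obtain x y where xy: "x \<in> S - {0}" "y \<in> S" "q * n + n + j = q * x + y"
    unfolding dilate_sum_def by auto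
  obtain i where i: "x = n + i"
    using xy(1) unfolding S_def by (auto dest!: le_Suc_ex)
  have m: "n + j = q * i + y"
    using xy(3) unfolding i by (simp add: algebra_simps)
  \<comment> \<open>From \<open>2 * i \<le> n + j < 2 * n\<close> it follows that
    \<open>x = n + i < 2 * n\<close>, so \<open>x\<close> is a generator.\<close>
  have "2 * i \<le> q * i" using assms by simp
  then have "i < n" using m assms by linarith
  then have "i \<le> t" using xy(1) unfolding i S_def by auto
  from m have "y < 2 * n" using assms by linarith
  then have "y = 0 \<or> n \<le> y \<and> y \<le> n + t" using xy(2) unfolding S_def by auto
  then show "(\<exists>i. q * i \<le> j \<and> j \<le> q * i + t) \<or> (\<exists>i\<le>t. n + j = q * i)"
  proof
    assume "y = 0"
    then show ?thesis using m \<open>i \<le> t\<close> by auto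
  next
    assume "n \<le> y \<and> y \<le> n + t"
    then have "q * i \<le> j \<and> j \<le> q * i + t" using m by linarith
    then show ?thesis by blast
  qed
next
  assume "(\<exists>i. q * i \<le> j \<and> j \<le> q * i + t) \<or> (\<exists>i\<le>t. n + j = q * i)"
  then show "q * n + n + j \<in> dilate_sum q S"
  proof (elim disjE exE conjE)
    fix i assume i: "q * i \<le> j" "j \<le> q * i + t"
    \<comment> \<open>The bound \<open>i \<le> t\<close>, absent from the first disjunct, follows
      from \<open>2 * i \<le> j < n \<le> 2 * t + 1\<close>.\<close>
    have "2 * i \<le> q * i" using assms by simp
    then have "i \<le> t" using i assms by linarith
    then have "n + i \<in> S - {0}" "n + j - q * i \<in> S"
      "q * n + n + j = q * (n + i) + (n + j - q * i)"
      using assms i unfolding S_def by (auto simp: algebra_simps)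
    then show ?thesis
      unfolding dilate_sum_def by blast
  next
    fix i assume "i \<le> t" "n + j = q * i"
    then have "n + i \<in> S - {0}" "0 \<in> S" "q * n + n + j = q * (n + i) + 0"
      using assms unfolding S_def by (auto simp: algebra_simps)
    then show ?thesis
      unfolding dilate_sum_def by blast
  qed
qed

section \<open>Counting the complement\<close>

text \<open>\<open>q * i < n\<close> means \<open>i < n / q\<close>, that is, \<open>i\<close> is
  below the ceiling; \<open>i = 0\<close> is included.\<close>

lemma card_multiples_less:
  fixes n q :: nat
  assumes "0 < q"
  shows "int (card {m. m < n \<and> q dvd m}) = \<lceil>real n / real q\<rceil>"
proof -
  define N where "N = nat \<lceil>real n / real q\<rceil>"
  have "i < N \<longleftrightarrow> q * i < n" for i
  proof -
    have "i < N \<longleftrightarrow> real i < real n / real q"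
      unfolding N_def by (simp add: zless_nat_eq_int_zless less_ceiling_iff)
    also have "\<dots> \<longleftrightarrow> real (q * i) < real n"
      using assms by (simp add: field_simps)
    finally show ?thesis by (simp only: of_nat_less_iff)
  qed
  then have "{i. q * i < n} = {..<N}" by blast
  moreover have "{m. m < n \<and> q dvd m} = (*) q ` {i. q * i < n}"
    by (auto elim: dvdE)
  moreover have "inj_on ((*) q) {..<N}"
    using assms by (intro inj_onI) simp
  ultimately have "card {m. m < n \<and> q dvd m} = N"
    by (simp add: card_image)
  moreover have "- 1 < real n / real q"
    by (rule order_less_le_trans[of _ 0]) simp_all
  then have "0 \<le> \<lceil>real n / real q\<rceil>"
    by (simp only: zero_le_ceiling)
  ultimately show ?thesis
    unfolding N_def by simp
qed

text \<open>The complement splits into the part of \<open>S\<close> below \<open>q * n\<close>, with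
  \<open>2 + t + (q - 2) * n\<close> elements, the non-multiples of \<open>q\<close> in the lower
  half of the window, and the gap set \<open>U\<close> of the upper half. Only \<open>card U\<close>
  remains to be found for each range of \<open>q\<close>.\<close>

lemma GM_eq_window_count:
  fixes n t q :: nat
  defines "U \<equiv> {j. j < n \<and> (\<forall>i. q * i \<le> j \<longrightarrow> q * i + t < j) \<and> (\<forall>i\<le>t. n + j \<noteq> q * i)}"
  assumes "t < n" "n \<le> 2 * t + 1" "2 \<le> q"
  shows "int (GM q (nat_combinations {n..n + t})) =
    3 + (int q - 1) * int n - \<lceil>real n / real q\<rceil> + int t + int (card U)"
proof -
  define S where "S = {0} \<union> {n..n + t} \<union> {2 * n..}"
  define A where "A = {m. m < n \<and> q dvd m}"
  have n: "0 < n" using assms by simp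
  have qn: "2 * n \<le> q * n" using assms by simp
  have S: "nat_combinations {n..n + t} = S"
    unfolding S_def using n assms by (intro nat_combinations_interval)
  have lower: "q * n + m \<in> dilate_sum q S \<longleftrightarrow> m \<in> A" if "m < n" for m
    using dilate_sum_window_lower[of n t q m] assms n that unfolding S_def A_def by simp
  have upper: "q * n + n + j \<in> dilate_sum q S \<longleftrightarrow> j \<notin> U" if "j < n" for j
    using dilate_sum_window_upper[of n t q j] assms n that unfolding S_def U_def
    by (auto simp: not_less)
  have below: "m \<notin> dilate_sum q S" if "m < q * n" for m
  proof
    assume "m \<in> dilate_sum q S"
    then obtain x y where "x \<in> S - {0}" "m = q * x + y"
      unfolding dilate_sum_def by auto
    moreover from this have "n \<le> x" unfolding S_def by auto
    then have "q * n \<le> q * x" by simp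
    ultimately show False using that by linarith
  qed
  have above: "m \<in> dilate_sum q S" if "q * n + 2 * n \<le> m" for m
  proof -
    have "n \<in> S - {0}" "m - q * n \<in> S" "m = q * n + (m - q * n)"
      using that n unfolding S_def by auto
    then show ?thesis unfolding dilate_sum_def by blast
  qed
  \<comment> \<open>This is all of \<open>S\<close> below \<open>q * n\<close>: since
    \<open>t < n\<close>, the generators lie below \<open>2 * n \<le> q * n\<close>. The last
    interval is empty for \<open>q = 2\<close>.\<close>
  let ?B = "insert 0 ({n..n + t} \<union> {2 * n..<q * n})"
  let ?L = "(+) (q * n) ` ({..<n} - A)"
  let ?U = "(+) (q * n + n) ` U"
  have B: "m < q * n" if "m \<in> ?B" for m
  proof -
    have "m < 2 * n \<or> m < q * n" using that n assms by auto
    then show ?thesis using qn by linarith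
  qed
  have "S - dilate_sum q S = ?B \<union> (?L \<union> ?U)"
  proof (intro equalityI subsetI)
    fix m assume m: "m \<in> S - dilate_sum q S"
    then have "m < q * n + 2 * n" using above[of m] by force
    then consider "m < q * n" | k where "k < n" "m = q * n + k"
      | k where "k < n" "m = q * n + n + k"
    proof -
      consider "m < q * n" | "q * n \<le> m" "m < q * n + n" | "q * n + n \<le> m"
        by linarith
      then show ?thesis
        using \<open>m < q * n + 2 * n\<close> that(1) that(2)[of "m - q * n"] that(3)[of "m - q * n - n"]
        by cases auto
    qed
    then show "m \<in> ?B \<union> (?L \<union> ?U)"
    proof cases
      case 1 then show ?thesis using m unfolding S_def by auto
    next
      case 2 then show ?thesis using m lower by auto
    next
      case 3
      then have "k \<in> U" using m upper by auto
      then show ?thesis using 3 by auto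
    qed
  next
    fix m assume "m \<in> ?B \<union> (?L \<union> ?U)"
    then consider "m \<in> ?B" | k where "k < n" "k \<notin> A" "m = q * n + k"
      | k where "k \<in> U" "m = q * n + n + k" by auto
    then show "m \<in> S - dilate_sum q S"
    proof cases
      case 1
      then have "m \<notin> dilate_sum q S" by (intro below B)
      then show ?thesis using 1 unfolding S_def by auto
    next
      case 2
      then have "2 * n \<le> m" using qn by linarith
      then have "m \<in> S" unfolding S_def by simp
      then show ?thesis using 2 lower by simp
    next
      case 3
      then have "k < n" unfolding U_def by simp
      moreover have "2 * n \<le> m" using 3 qn by linarith
      then have "m \<in> S" unfolding S_def by simp
      ultimately show ?thesis using 3 upper by simp
    qed
  qed
  moreover have "card (?B \<union> (?L \<union> ?U)) = card ?B + (card ?L + card ?U)"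
  proof -
    have "U \<subseteq> {..<n}" unfolding U_def by auto
    then have fin: "finite U" by (rule finite_subset) simp
    have "q * n \<le> m" if "m \<in> ?L \<union> ?U" for m
      using that by auto
    then have "?B \<inter> (?L \<union> ?U) = {}"
      using B by (meson disjoint_iff leD)
    moreover have "?L \<inter> ?U = {}"
      by force
    ultimately show ?thesis using fin by (subst card_Un_disjoint; simp add: card_Un_disjoint)
  qed
  moreover have "card ?B = 2 + t + (q * n - 2 * n)"
  proof -
    have "{n..n + t} \<inter> {2 * n..<q * n} = {}" using assms by auto
    then have "card ({n..n + t} \<union> {2 * n..<q * n}) = t + 1 + (q * n - 2 * n)"
      by (subst card_Un_disjoint) auto
    then show ?thesis using n by (subst card_insert_disjoint) auto
  qed
  moreover have "card ?L = n - card A" "card A \<le> n"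
  proof -
    have "A \<subseteq> {..<n}" unfolding A_def by auto
    then show "card ?L = n - card A" "card A \<le> n"
      using card_mono[of "{..<n}" A] finite_subset[of A "{..<n}"]
      by (auto simp: card_image card_Diff_subset)
  qed
  moreover have "card ?U = card U"
    by (simp add: card_image)
  moreover have "int (card A) = \<lceil>real n / real q\<rceil>"
    unfolding A_def using assms by (intro card_multiples_less) simp
  ultimately have
    "card (S - dilate_sum q S) = (2 + t + (q * n - 2 * n)) + ((n - card A) + card U)"
    and A: "card A \<le> n" "int (card A) = \<lceil>real n / real q\<rceil>"
    by (simp_all only:)
  moreover have "int (q * n - 2 * n) = int q * int n - 2 * int n"
    by (simp only: of_nat_diff[OF qn] of_nat_mult of_nat_numeral)
  moreover have "int (n - card A) = int n - int (card A)"
    using A(1) by (rule of_nat_diff)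
  ultimately have "int (card (S - dilate_sum q S)) =
      (2 + int t + (int q * int n - 2 * int n)) + ((int n - int (card A)) + int (card U))"
    by (simp only: of_nat_add of_nat_numeral)
  then show ?thesis
    unfolding GM_def S by (simp add: A(2) algebra_simps)
qed

section \<open>The gap set in the three ranges of \<open>q\<close>\<close>

theorem theorem4p4:
  fixes n t q :: nat and S :: "nat set"
  assumes "q \<ge> 2"
    and "S = nat_combinations {n..n + t}"
    and "\<lceil>(real n - 1) / 2\<rceil> \<le> int t" and "t < n" and "t \<noteq> 1"
  shows "(q \<le> t + 1 \<longrightarrow>
            int (GM q S) = 3 + (int q - 1) * int n - \<lceil>real n / real q\<rceil> + int t)
       \<and> (t + 2 \<le> q \<and> int q \<le> int n - 1 \<longrightarrow>
            int (GM q S) = 4 + (int q - 1) * int n + int q - 2 * \<lceil>real n / real q\<rceil>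
              + \<lfloor>(real t + real n) / real q\<rfloor>
              - max \<lfloor>(real t + real n) / real q\<rfloor> (min (1 + \<lfloor>real n / real q\<rfloor>) (int t)))
       \<and> (n \<le> q \<longrightarrow>
            int (GM q S) = 2 + int q * int n - \<lceil>2 * real n / real q\<rceil>
              + \<lfloor>(real t + real n) / real q\<rfloor>)"
proof -
  have "(real n - 1) / 2 \<le> real t"
    using assms(3) by (simp add: ceiling_le_iff)
  then have "real n \<le> real (2 * t + 1)" by simp
  then have nt: "n \<le> 2 * t + 1" by (simp only: of_nat_le_iff)
  define U where
    "U = {j. j < n \<and> (\<forall>i. q * i \<le> j \<longrightarrow> q * i + t < j) \<and> (\<forall>i\<le>t. n + j \<noteq> q * i)}"
  have GM: "int (GM q S) =
      3 + (int q - 1) * int n - \<lceil>real n / real q\<rceil> + int t + int (card U)"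
    unfolding assms(2) U_def using assms nt by (intro GM_eq_window_count)
  have case1: "card U = 0" if "q \<le> t + 1"
  proof -
    have "j \<notin> U" for j
    proof
      assume "j \<in> U"
      \<comment> \<open>The remainder of \<open>j\<close> modulo \<open>q\<close> is at most
        \<open>q - 1 \<le> t\<close>, so the translate starting at \<open>q * (j div q)\<close>
        covers \<open>j\<close>.\<close>
      then have "q * (j div q) + t < j" unfolding U_def by simp
      moreover have "q * (j div q) + j mod q = j" "j mod q < q" using assms(1) by simp_all
      ultimately show False using that by linarith
    qed
    then have "U = {}" by blast
    then show ?thesis by simp
  qed
  have case2: "int (GM q S) = 4 + (int q - 1) * int n + int q - 2 * \<lceil>real n / real q\<rceil>
              + \<lfloor>(real t + real n) / real q\<rfloor>
              - max \<lfloor>(real t + real n) / real q\<rfloor> (min (1 + \<lfloor>real n / real q\<rfloor>) (int t))"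
    if q: "t + 2 \<le> q" "int q \<le> int n - 1"
  proof -
    \<comment> \<open>\<open>t + 2 \<le> q \<le> n - 1 \<le> 2 * t\<close>. This admits
      \<open>i = 2\<close> in \<open>U\<close> and makes the minimum in the formula equal to
      2.\<close>
    have t: "2 \<le> t" using q nt assms by linarith
    have "q < n" "n < 2 * q" using q nt by linarith+
    then have ceil: "\<lceil>real n / real q\<rceil> = 2" and floor: "\<lfloor>real n / real q\<rfloor> = 1"
      by (auto simp: ceiling_eq_iff floor_eq_iff field_simps)
    have floor': "\<lfloor>(real t + real n) / real q\<rfloor> = (if 2 * q \<le> n + t then 2 else 1)"
      using \<open>q < n\<close> \<open>n < 2 * q\<close> q by (auto simp: floor_eq_iff field_simps)
    \<comment> \<open>The translate starting at \<open>q\<close> reaches past \<open>n\<close>,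
      since \<open>n \<le> 2 * t + 1 < q + t\<close>, leaving one gap. There
      \<open>q < n + j < 3 * q\<close>, so \<open>2 * q\<close> is the only possible
      multiple.\<close>
    have U: "U = {t<..<q} - {2 * q - n}"
    proof (intro equalityI subsetI)
      fix j assume j: "j \<in> U"
      then have "q * 0 \<le> j \<longrightarrow> q * 0 + t < j" unfolding U_def by blast
      then have "t < j" by simp
      moreover have "j < q"
      proof (rule ccontr)
        assume "\<not> j < q"
        then have "q * 1 \<le> j" by simp
        then have "q * 1 + t < j" using j unfolding U_def by blast
        then show False using j q nt unfolding U_def by simp
      qed
      moreover have "n + j \<noteq> q * 2" using j t unfolding U_def by blast
      ultimately show "j \<in> {t<..<q} - {2 * q - n}" using \<open>n < 2 * q\<close> by auto
    next
      fix j assume j: "j \<in> {t<..<q} - {2 * q - n}"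
      have "q * i + t < j" if "q * i \<le> j" for i
      proof (cases i)
        case 0 then show ?thesis using j by simp
      next
        case (Suc k) then show ?thesis using that j by simp
      qed
      moreover have "n + j \<noteq> q * i" for i
      proof
        assume "n + j = q * i"
        moreover have "q * 1 < n + j" "n + j < q * 3" "n + j \<noteq> q * 2"
          using j \<open>q < n\<close> \<open>n < 2 * q\<close> by auto
        ultimately show False by auto
      qed
      ultimately show "j \<in> U" using j \<open>q < n\<close> unfolding U_def by auto
    qed
    show ?thesis
    \<comment> \<open>The maximum in the formula is 2 in both cases. If the condition holds,
      \<open>2 * q - n \<le> t\<close> lies outside the gap; otherwise it removes one
      element.\<close>
    proof (cases "2 * q \<le> n + t")
      case True
      then have "U = {t<..<q}" unfolding U by auto
      then show ?thesis using GM ceil floor floor' True t q by (simp add: of_nat_diff)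
    next
      case False
      then have "2 * q - n \<in> {t<..<q}" using \<open>q < n\<close> by auto
      then have "card U = q - t - 2" unfolding U by (subst card_Diff_singleton) auto
      then show ?thesis using GM ceil floor floor' False t q by (simp add: of_nat_diff)
    qed
  qed
  have case3: "int (GM q S) = 2 + int q * int n - \<lceil>2 * real n / real q\<rceil>
              + \<lfloor>(real t + real n) / real q\<rfloor>"
    if q: "n \<le> q"
  proof -
    have ceil: "\<lceil>real n / real q\<rceil> = 1"
      using assms q by (auto simp: ceiling_eq_iff field_simps)
    have ceil': "\<lceil>2 * real n / real q\<rceil> = (if 2 * n \<le> q then 1 else 2)"
      using assms q by (auto simp: ceiling_eq_iff field_simps)
    have floor': "\<lfloor>(real t + real n) / real q\<rfloor> = (if q \<le> n + t then 1 else 0)"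
      using assms q by (auto simp: floor_eq_iff field_simps)
    have U: "U = {t<..<n} - {q - n}"
    proof (intro equalityI subsetI)
      fix j assume j: "j \<in> U"
      then have "q * 0 \<le> j \<longrightarrow> q * 0 + t < j" unfolding U_def by blast
      then have "t < j" by simp
      \<comment> \<open>\<open>t = 0\<close> would give \<open>n \<le> 1\<close>, leaving no
        \<open>j\<close> with \<open>t < j < n\<close>. Hence \<open>i = 1\<close> is admissible in
        \<open>U\<close>.\<close>
      then have "1 \<le> t" using j nt unfolding U_def by simp
      then have "n + j \<noteq> q * 1" using j unfolding U_def by blast
      then show "j \<in> {t<..<n} - {q - n}" using j \<open>t < j\<close> q unfolding U_def by auto
    next
      fix j assume j: "j \<in> {t<..<n} - {q - n}"
      have "q * i + t < j" if "q * i \<le> j" for i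
      proof (cases i)
        case 0 then show ?thesis using j by simp
      next
        case (Suc k) then show ?thesis using that j q by simp
      qed
      moreover have "n + j \<noteq> q * i" for i
      proof
        assume "n + j = q * i"
        moreover have "q * 0 < n + j" "n + j < q * 2" "n + j \<noteq> q * 1"
          using j q by auto
        ultimately show False by auto
      qed
      ultimately show "j \<in> U" using j unfolding U_def by auto
    qed
    show ?thesis
    \<comment> \<open>This is exactly when \<open>q - n\<close> lies in \<open>{t<..<n}\<close>. If
      it fails, either \<open>q \<le> n + t\<close>, with ceiling 2 and floor 1, or
      \<open>2 * n \<le> q\<close>, with ceiling 1 and floor 0; both give the same value.\<close>
    proof (cases "n + t < q \<and> q < 2 * n")
      case True
      then have "q - n \<in> {t<..<n}" by auto
      then have "card U = n - t - 2" unfolding U by (subst card_Diff_singleton) auto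
      then show ?thesis using GM ceil ceil' floor' True assms
        by (simp add: of_nat_diff algebra_simps)
    next
      case False
      then have "U = {t<..<n}" unfolding U by auto
      then show ?thesis using GM ceil ceil' floor' False assms
        by (auto simp: of_nat_diff algebra_simps)
    qed
  qed
  show ?thesis
    using GM case1 case2 case3 by simp
qed

end
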